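(* Let $I \subseteq \mathbb{R}$ be an open interval and $a \in I$. If $S : I \to \mathbb{R}$ is a solution to $\mathbf{XX}$ on $I$, with $S(a) = 0$ and $S(t) > 0$ for all $t \in I \setminus \{a\}$, then there exists a solution $s : I \to \mathbb{R}$ to $\mathbf{PII}_0$ on $I$ such that $S = s^2$.
   Context: Everything is real: $t$ is a real variable and solutions are real-valued. The homogeneous second Painlevé equation $\mathbf{PII}_0$ is $$s'' = 2 s^3 + t s;$$ a solution on an open interval $I$ is a twice-differentiable function $s : I \to \mathbb{R}$ with $s''(t) = 2s(t)^3 + t s(t)$ for all $t \in I$. Equation $\mathbf{XX}$ is $$S'' = \frac{(S')^2}{2S} + 4 S^2 + 2 t S,$$ where the ratio $(S')^2/(2S)$ is understood as a limit at zeros of $S$. Precisely, a solution to $\mathbf{XX}$ on an open interval $I$ is a twice-differentiable function $S : I \to \mathbb{R}$ such that (i) at every $t \in I$ with $S(t) \neq 0$ one has $S''(t) = \frac{S'(t)^2}{2S(t)} + 4S(t)^2 + 2tS(t)$; and (ii) at every isolated zero $a \in I$ of $S$ the limit $\lim_{t \to a,\, t\neq a} \frac{S'(t)^2}{2S(t)}$ exists as a real number and $S''(a) = \lim_{t \to a} \frac{S'(t)^2}{2S(t)} + 4S(a)^2 + 2aS(a)$. *)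

theory Defs
  imports "HOL-Analysis.Analysis"
begin

(* Functions on an open set I are represented by total functions whose values
   outside I are irrelevant: for t in the open set I, the derivatives at t
   depend only on the values of the function in I. *)

definition twice_differentiable_on :: "(real \<Rightarrow> real) \<Rightarrow> real set \<Rightarrow> bool"
    (infix "twice'_differentiable'_on" 50)
  where "f twice_differentiable_on I \<longleftrightarrow>
    (\<forall>t\<in>I. f differentiable (at t) \<and> deriv f differentiable (at t))"

definition solves_PII0_on :: "(real \<Rightarrow> real) \<Rightarrow> real set \<Rightarrow> bool"
    (infix "solves'_PII0'_on" 50)
  where "s solves_PII0_on I \<longleftrightarrow>
    s twice_differentiable_on I \<and>
    (\<forall>t\<in>I. deriv (deriv s) t = 2 * s t ^ 3 + t * s t)"

(* Nothing is required at non-isolated zeros of S beyond twice differentiability. *)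

definition solves_XX_on :: "(real \<Rightarrow> real) \<Rightarrow> real set \<Rightarrow> bool"
    (infix "solves'_XX'_on" 50)
  where "S solves_XX_on I \<longleftrightarrow>
    S twice_differentiable_on I \<and>
    (\<forall>t\<in>I. S t \<noteq> 0 \<longrightarrow>
       deriv (deriv S) t = (deriv S t)\<^sup>2 / (2 * S t) + 4 * (S t)\<^sup>2 + 2 * t * S t) \<and>
    (\<forall>a. a isolated_in {t \<in> I. S t = 0} \<longrightarrow>
       (\<exists>L. ((\<lambda>t. (deriv S t)\<^sup>2 / (2 * S t)) \<longlongrightarrow> L) (at a) \<and>
            deriv (deriv S) a = L + 4 * (S a)\<^sup>2 + 2 * a * S a))"

end

theory Submission
  imports Defs
begin

text \<open>
  The function \<open>\<surd>S\<close> solves \<open>PII\<^sub>0\<close> wherever \<open>S > 0\<close>, by direct computation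
  (\<open>DERIV_sqrt_XX\<close>), and so does \<open>- \<surd>S\<close> because the equation is odd in its unknown.
  If \<open>S\<close> vanishes to exact order two at \<open>a\<close>, then \<open>\<surd>S\<close> has a corner there, like
  \<open>\<bar>t - a\<bar>\<close>, and a sign change at \<open>a\<close> removes it; hence the candidate
  \<open>s(t) = sgn (t - a) \<surd>(S(t))\<close>.

  It remains to pass through \<open>a\<close>. Condition (ii) of \<open>XX\<close> gives a limit \<open>L\<close> of
  \<open>S'\<^sup>2 / (2 S)\<close> at \<open>a\<close>, and \<open>L = S''(a)\<close> because \<open>S(a) = 0\<close>. Off \<open>a\<close>
  we have \<open>s'\<^sup>2 = S'\<^sup>2 / (4 S)\<close>, so \<open>\<bar>s'\<bar>\<close> tends to \<open>\<surd>(L/2)\<close>. For \<open>L > 0\<close> the point \<open>a\<close>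
  is a minimum at which \<open>S'\<close> vanishes with positive slope, so \<open>S'\<close> has the sign of
  \<open>t - a\<close> and \<open>s' > 0\<close> near \<open>a\<close>; for \<open>L = 0\<close> no sign is needed. Either way
  \<open>s'\<close> tends to \<open>\<surd>(L/2)\<close> (\<open>signed_sqrt_slope_tendsto\<close>). A continuous function whose
  derivative has a limit at a point is differentiable there with that derivative
  (\<open>DERIV_from_limit\<close>). Applied to \<open>s\<close>, and then to \<open>s'\<close>, whose derivative
  \<open>2 s\<^sup>3 + t s\<close> is continuous, this gives the equation at \<open>a\<close>.
\<close>

text \<open>The difference quotient is a quotient of two functions that vanish at \<open>a\<close>, so l'Hopital's
  rule computes its limit.\<close>

lemma DERIV_from_limit:
  fixes f f' :: "real \<Rightarrow> real"
  assumes cont: "(f \<longlongrightarrow> f a) (at a)"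
    and deriv: "\<forall>\<^sub>F t in at a. (f has_real_derivative f' t) (at t)"
    and lim: "(f' \<longlongrightarrow> c) (at a)"
  shows "(f has_real_derivative c) (at a)"
proof -
  have "((\<lambda>t. (f t - f a) / (t - a)) \<longlongrightarrow> c) (at a)"
  proof (rule lhopital)
    show "((\<lambda>t. f t - f a) \<longlongrightarrow> 0) (at a)"
      using cont by (simp add: LIM_zero)
    show "((\<lambda>t. t - a) \<longlongrightarrow> 0) (at a)"
      by (simp add: LIM_zero)
    show "\<forall>\<^sub>F t in at a. t - a \<noteq> 0"
      by (simp add: eventually_at_filter)
    show "\<forall>\<^sub>F t in at a. (1::real) \<noteq> 0"
      by simp
    show "\<forall>\<^sub>F t in at a. ((\<lambda>t. f t - f a) has_real_derivative f' t) (at t)"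
      using deriv by eventually_elim (auto intro!: derivative_eq_intros)
    show "\<forall>\<^sub>F t in at a. ((\<lambda>t. t - a) has_real_derivative 1) (at t)"
      by (auto intro!: always_eventually derivative_eq_intros)
    show "((\<lambda>t. f' t / 1) \<longlongrightarrow> c) (at a)"
      using lim by simp
  qed
  then show ?thesis
    by (simp add: has_field_derivative_iff)
qed

lemma DERIV_sgn_mult:
  fixes f :: "real \<Rightarrow> real"
  assumes "(f has_real_derivative D) (at t)" and "t \<noteq> a"
  shows "((\<lambda>x. sgn (x - a) * f x) has_real_derivative sgn (t - a) * D) (at t)"
proof (rule has_field_derivative_transform_within_open)
  show "((\<lambda>x. sgn (t - a) * f x) has_real_derivative sgn (t - a) * D) (at t)"
    by (rule DERIV_cmult[OF assms(1)])
  show "open (if t < a then {..<a} else {a<..})" "t \<in> (if t < a then {..<a} else {a<..})"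
    using assms(2) by auto
  show "sgn (t - a) * f x = sgn (x - a) * f x"
    if "x \<in> (if t < a then {..<a} else {a<..})" for x
    using that assms(2) by (auto split: if_splits)
qed

text \<open>The term \<open>S'\<^sup>2 / (2 S)\<close> in \<open>XX\<close> cancels the term that comes from differentiating the denominator
  of \<open>(\<surd>S)' = S' / (2 \<surd>S)\<close>.\<close>

lemma DERIV_sqrt_XX:
  fixes S S' :: "real \<Rightarrow> real"
  assumes "S t > 0"
    and S: "(S has_real_derivative S' t) (at t)"
    and S': "(S' has_real_derivative (S' t)\<^sup>2 / (2 * S t) + 4 * (S t)\<^sup>2 + 2 * t * S t) (at t)"
  shows "((\<lambda>x. sqrt (S x)) has_real_derivative S' t / (2 * sqrt (S t))) (at t)"
    and "((\<lambda>x. S' x / (2 * sqrt (S x))) has_real_derivative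
           2 * sqrt (S t) ^ 3 + t * sqrt (S t)) (at t)"
proof -
  define r where "r = sqrt (S t)"
  have r: "r > 0" "S t = r\<^sup>2"
    using assms(1) by (auto simp: r_def)
  show *: "((\<lambda>x. sqrt (S x)) has_real_derivative S' t / (2 * sqrt (S t))) (at t)"
    using assms(1) by (auto intro!: derivative_eq_intros S simp: field_simps)
  show "((\<lambda>x. S' x / (2 * sqrt (S x))) has_real_derivative
           2 * sqrt (S t) ^ 3 + t * sqrt (S t)) (at t)"
    by (rule DERIV_cong[OF DERIV_divide[OF S' DERIV_cmult[OF *, of 2]]])
       (use r in \<open>auto simp: field_simps power2_eq_square power3_eq_cube\<close>)
qed

text \<open>This is where the choice of sign pays off: \<open>\<surd>S\<close> alone would have slope tending to
  \<open>\<surd>(L/2)\<close> on the right of \<open>a\<close> and to \<open>- \<surd>(L/2)\<close> on the left.\<close>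

lemma signed_sqrt_slope_tendsto:
  fixes S S' :: "real \<Rightarrow> real"
  assumes pos: "\<forall>\<^sub>F t in at a. S t > 0"
    and lim: "((\<lambda>t. (S' t)\<^sup>2 / (2 * S t)) \<longlongrightarrow> L) (at a)"
    and "S' a = 0"
    and S': "(S' has_real_derivative L) (at a)"
  shows "((\<lambda>t. sgn (t - a) * (S' t / (2 * sqrt (S t)))) \<longlongrightarrow> sqrt (L / 2)) (at a)"
    (is "(?g \<longlongrightarrow> _) _")
proof -
  have "((\<lambda>t. sqrt ((S' t)\<^sup>2 / (2 * S t) / 2)) \<longlongrightarrow> sqrt (L / 2)) (at a)"
    by (intro tendsto_intros lim) simp
  moreover have "\<forall>\<^sub>F t in at a. sqrt ((S' t)\<^sup>2 / (2 * S t) / 2) = \<bar>?g t\<bar>"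
    using pos eventually_neq_at_within[of a a UNIV]
    by eventually_elim (simp add: real_sqrt_divide real_sqrt_mult abs_mult abs_sgn_eq)
  ultimately have abs: "((\<lambda>t. \<bar>?g t\<bar>) \<longlongrightarrow> sqrt (L / 2)) (at a)"
    by (rule Lim_transform_eventually)
  have "L \<ge> 0"
    by (rule tendsto_lowerbound[OF lim]) (use pos in \<open>auto elim!: eventually_mono\<close>)
  then consider "L = 0" | "L > 0"
    by linarith
  then show ?thesis
  proof cases
    assume "L = 0"
    with abs have "((\<lambda>t. \<bar>?g t\<bar>) \<longlongrightarrow> 0) (at a)"
      by (simp only:) simp
    then show ?thesis
      unfolding tendsto_rabs_zero_iff using \<open>L = 0\<close> by simp
  next
    assume "L > 0"
    have "((\<lambda>t. S' t / (t - a)) \<longlongrightarrow> L) (at a)"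
      using S' \<open>S' a = 0\<close> by (simp add: has_field_derivative_iff)
    then have "\<forall>\<^sub>F t in at a. S' t / (t - a) > 0"
      using \<open>L > 0\<close> by (rule order_tendstoD)
    then have "\<forall>\<^sub>F t in at a. \<bar>?g t\<bar> = ?g t"
      using pos
      by eventually_elim (auto simp: zero_less_divide_iff sgn_if abs_if divide_less_0_iff)
    then show ?thesis
      by (rule Lim_transform_eventually[OF abs])
  qed
qed

theorem theorem6:
  fixes I :: "real set" and a :: real and S :: "real \<Rightarrow> real"
  assumes "open I" and "is_interval I" and "a \<in> I"
    and "S solves_XX_on I"
    and "S a = 0"
    and "\<And>t. t \<in> I - {a} \<Longrightarrow> S t > 0"
  shows "\<exists>s :: real \<Rightarrow> real. s solves_PII0_on I \<and> (\<forall>t\<in>I. S t = (s t)\<^sup>2)"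
proof -
  note pos = assms(6)
  have S: "(S has_real_derivative deriv S t) (at t)"
    and S': "(deriv S has_real_derivative deriv (deriv S) t) (at t)" if "t \<in> I" for t
    using assms(4) that
    by (auto simp: solves_XX_on_def twice_differentiable_on_def DERIV_deriv_iff_real_differentiable)
  have XX: "deriv (deriv S) t = (deriv S t)\<^sup>2 / (2 * S t) + 4 * (S t)\<^sup>2 + 2 * t * S t"
    if "t \<in> I - {a}" for t
    using assms(4) that pos[OF that] by (auto simp: solves_XX_on_def)
  have near: "\<forall>\<^sub>F t in at a. t \<in> I - {a}"
    using assms(1,3) by (auto simp: eventually_at_topological)

  have "{t \<in> I. S t = 0} = {a}"
    using assms(3,5) pos by force
  then have "a isolated_in {t \<in> I. S t = 0}"
    by (auto simp: isolated_in_def intro!: exI[of _ UNIV])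
  then obtain L where lim: "((\<lambda>t. (deriv S t)\<^sup>2 / (2 * S t)) \<longlongrightarrow> L) (at a)"
    and L: "deriv (deriv S) a = L"
    using assms(4,5) unfolding solves_XX_on_def by fastforce
  obtain d where d: "d > 0" "ball a d \<subseteq> I"
    using assms(1,3) by (auto simp: open_contains_ball)
  have "deriv S a = 0"
  proof (rule DERIV_local_min[OF S[OF assms(3)] d(1)], intro allI impI)
    fix t assume "\<bar>a - t\<bar> < d"
    then have "t \<in> I"
      using d(2) by (auto simp: dist_real_def)
    then show "S a \<le> S t"
      using assms(5) pos[of t] by (cases "t = a") auto
  qed

  define s where "s t = sgn (t - a) * sqrt (S t)" for t
  \<comment> \<open>At \<open>a\<close> the quotient is \<open>0/0\<close>, so the limit of \<open>s'\<close> is put in by hand.\<close>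
  define s' where
    "s' t = (if t = a then sqrt (L / 2) else sgn (t - a) * (deriv S t / (2 * sqrt (S t))))" for t
  have sa: "s a = 0"
    by (simp add: s_def)

  have s_off: "(s has_real_derivative s' t) (at t)"
    and s'_off: "(s' has_real_derivative 2 * s t ^ 3 + t * s t) (at t)"
    if t: "t \<in> I - {a}" for t
  proof -
    have "t \<in> I" "t \<noteq> a"
      using t by auto
    note D = DERIV_sqrt_XX[of S t "deriv S", OF pos[OF t] S[OF \<open>t \<in> I\<close>]
        S'[OF \<open>t \<in> I\<close>, unfolded XX[OF t]]]
    show "(s has_real_derivative s' t) (at t)"
      using DERIV_sgn_mult[OF D(1) \<open>t \<noteq> a\<close>] \<open>t \<noteq> a\<close> by (simp add: s_def[abs_def] s'_def)
    have "sgn (t - a) ^ 3 = sgn (t - a)"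
      by (simp add: sgn_if)
    then have "2 * s t ^ 3 + t * s t = sgn (t - a) * (2 * sqrt (S t) ^ 3 + t * sqrt (S t))"
      by (simp add: s_def power_mult_distrib algebra_simps)
    with DERIV_sgn_mult[OF D(2) \<open>t \<noteq> a\<close>]
    have "((\<lambda>x. sgn (x - a) * (deriv S x / (2 * sqrt (S x))))
            has_real_derivative 2 * s t ^ 3 + t * s t) (at t)"
      by simp
    then show "(s' has_real_derivative 2 * s t ^ 3 + t * s t) (at t)"
      by (rule has_field_derivative_transform_within_open[where S = "- {a}"])
         (use \<open>t \<noteq> a\<close> in \<open>auto simp: s'_def\<close>)
  qed

  have "((\<lambda>t. sqrt (S t)) \<longlongrightarrow> sqrt (S a)) (at a)"
    using DERIV_isCont[OF S[OF assms(3)]] by (intro tendsto_intros) (simp add: isCont_def)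
  then have "((\<lambda>t. sqrt (S t)) \<longlongrightarrow> 0) (at a)"
    using assms(5) by simp
  moreover have "\<forall>\<^sub>F t in at a. norm (s t) \<le> sqrt (S t)"
    using near
  proof eventually_elim
    case (elim t)
    then show ?case
      using pos[OF elim] by (simp add: s_def abs_mult abs_sgn_eq)
  qed
  ultimately have "(s \<longlongrightarrow> 0) (at a)"
    by (rule Lim_null_comparison[rotated])
  then have s_cont: "(s \<longlongrightarrow> s a) (at a)"
    by (simp add: sa)
  have s'_cont: "(s' \<longlongrightarrow> s' a) (at a)"
  proof (rule Lim_transform_eventually)
    show "((\<lambda>t. sgn (t - a) * (deriv S t / (2 * sqrt (S t)))) \<longlongrightarrow> s' a) (at a)"
      using signed_sqrt_slope_tendsto[OF eventually_mono[OF near pos] lim \<open>deriv S a = 0\<close>]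
        S'[OF assms(3)] by (simp add: s'_def L)
    show "\<forall>\<^sub>F t in at a. sgn (t - a) * (deriv S t / (2 * sqrt (S t))) = s' t"
      by (auto simp: s'_def eventually_at_filter)
  qed

  have s_at: "(s has_real_derivative s' a) (at a)"
    by (rule DERIV_from_limit[OF s_cont eventually_mono[OF near s_off] s'_cont])
  have s'_at: "(s' has_real_derivative 2 * s a ^ 3 + a * s a) (at a)"
    by (rule DERIV_from_limit[OF s'_cont eventually_mono[OF near s'_off]])
       (assumption, intro tendsto_intros s_cont)
  have s: "(s has_real_derivative s' t) (at t)"
    and s': "(s' has_real_derivative 2 * s t ^ 3 + t * s t) (at t)" if "t \<in> I" for t
    using that s_off s'_off s_at s'_at by (cases "t = a"; auto)+
  have "(deriv s has_real_derivative 2 * s t ^ 3 + t * s t) (at t)" if "t \<in> I" for t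
    by (rule has_field_derivative_transform_within_open[OF s'[OF that] assms(1) that])
       (simp add: DERIV_imp_deriv[OF s])
  then have "s solves_PII0_on I"
    using s unfolding solves_PII0_on_def twice_differentiable_on_def real_differentiable_def
    by (blast intro: DERIV_imp_deriv)
  moreover have "S t = (s t)\<^sup>2" if "t \<in> I" for t
    using that assms(5) pos[of t]
    by (cases "t = a") (auto simp: s_def power_mult_distrib sgn_if)
  ultimately show ?thesis
    by blast
qed

end
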